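(* $$\lim_{X\to+\infty}\frac{\#\{0\le n\le X:\ \mathcal{J}_6(24n+3)\equiv 0\pmod 2\}}{X}=1.$$
   Context: Let $q=e^{2\pi i\tau}$, $(a;q)_\infty=\prod_{j\ge0}(1-aq^j)$, and $\eta(\tau)=q^{1/24}(q;q)_\infty$. Define $$j_6(\tau)=\left(\frac{\eta(2\tau)\eta(3\tau)^3}{\eta(\tau)\eta(6\tau)^3}\right)^3-3=\frac1q+\sum_{n\ge0}\mathcal{J}_6(n)q^n.$$ *)

theory Defs
  imports "HOL-Analysis.Analysis" "HOL-Computational_Algebra.Formal_Power_Series"
begin

text \<open>(q^k;q^k)_infinity = prod_{j>=1} (1 - q^(k j)) as a formal power series in q.
  The coefficient of q^n only depends on the factors with j <= n (for k >= 1),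
  so it is defined as the coefficient of the finite truncated product.\<close>
definition qpoch_fps :: "nat \<Rightarrow> rat fps" where
  "qpoch_fps k = Abs_fps (\<lambda>n. fps_nth (\<Prod>j\<in>{1..n}. 1 - fps_X ^ (k * j)) n)"

text \<open>G(q) = ((q^2;q^2)(q^3;q^3)^3 / ((q;q)(q^6;q^6)^3))^3, so that
  j_6 = q^(-1) G(q) - 3 (the eta-quotient has leading exponent q^(-1)).\<close>
definition j6_G :: "rat fps" where
  "j6_G = (qpoch_fps 2 * qpoch_fps 3 ^ 3 * inverse (qpoch_fps 1 * qpoch_fps 6 ^ 3)) ^ 3"

text \<open>j_6 = 1/q + sum_{n>=0} J6(n) q^n.\<close>
definition J6 :: "nat \<Rightarrow> rat" where
  "J6 n = fps_nth j6_G (n + 1) - (if n = 0 then 3 else 0)"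

end

(* Modulo 2 the series G = q (j_6 + 3) becomes psi(q) / psi(q^3)^3, where
   psi(q) = sum_k q^(k(k+1)/2), because (q;q)^3 = psi(q) and f(q^2) = f(q)^2 modulo 2.
   Taking the exponents 1 mod 3, then 1 mod 4, then 0 mod 2, and using modulo 2
     psi(q) psi(q^3) = psi(q^4) + q psi(q^12)
   before each of the last two steps, reduces this to psi(q) itself. Hence J6 (24 n + 3)
   is odd exactly when n is a triangular number, and these have density zero. *)

theory Submission
  imports Defs "HOL-Real_Asymp.Real_Asymp" "HOL-Library.Z2" "HOL-Library.Nat_Bijection" "HOL-Library.Disjoint_Sets"
begin

text \<open>Extraction of the exponents r mod m commutes with multiplication by a series in q^m, so
  at each step the denominator has to be such a series. In characteristic 2 this is arranged by
  multiplying by psi / psi: the denominators psi^3 and psi become psi^4 = psi(q^4) and psi^2 =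
  psi(q^2), while the numerator psi(q^3) becomes the product psi(q) psi(q^3). The identity for this
  product is a parity count of representations by s^2 + 3 t^2, where an involution leaves only
  points on the axes. The identity for (q;q)^3 comes from a finite sum of Gaussian binomials that is
  meaningful over every field. Since G has rational coefficients, reduction modulo 2 is expressed
  through integer lifts of the coefficients.\<close>

unbundle no vec_syntax
unbundle fps_syntax

declare add_bit_eq_xor [simp del] mult_bit_eq_and [simp del]

section \<open>Arithmetic in characteristic 2\<close>

lemma bit_add_self: "x + x = (0::bit)"
  by (cases x) simp_all

lemma fps_bit_add_self: "f + f = (0::bit fps)"
  by (simp add: fps_eq_iff bit_add_self)

lemma fps_bit_uminus: "- f = (f::bit fps)"
  using fps_bit_add_self[of f] by (simp add: minus_unique)

lemma of_int_bit: "(of_int k :: bit) = of_bool (odd k)"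
proof -
  have "(of_int (2 * m) :: bit) = 0" "(of_int (2 * m + 1) :: bit) = 1" for m
    by (simp_all only: of_int_mult of_int_add of_int_numeral bit_2_eq_0 mult_zero_left) simp_all
  then show ?thesis
    by (cases "even k") (auto elim!: evenE oddE)
qed

text \<open>Each two-element orbit of \<open>h\<close> contributes
  \<open>v x + v x = 0\<close>.\<close>

lemma sum_bit_involution:
  fixes v :: "'a \<Rightarrow> bit"
  assumes "finite S" "\<And>x. x \<in> S \<Longrightarrow> h x \<in> S" "\<And>x. x \<in> S \<Longrightarrow> h (h x) = x"
    and "\<And>x. x \<in> S \<Longrightarrow> v (h x) = v x"
  shows "sum v S = sum v {x \<in> S. h x = x}"
proof -
  have "sum v (S - {x \<in> S. h x = x}) = 0"
  proof (rule sum_involution_eq_0[where h = h])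
    fix x assume "x \<in> S - {x \<in> S. h x = x}"
    then have x: "x \<in> S" "h x \<noteq> x" by auto
    show "v (h x) + v x = 0" using x assms(4) by (simp add: bit_add_self)
    show "h x \<in> S - {x \<in> S. h x = x}" using x assms(2,3)[of x] by auto
    show "h (h x) = x" "h x \<noteq> x" using x assms(3) by auto
  qed
  then show ?thesis
    using sum.subset_diff[of "{x \<in> S. h x = x}" S v] assms(1) by auto
qed

subsection \<open>Substituting powers of the variable\<close>

lemma fps_nth_compose_X_power:
  fixes f :: "'a::idom fps"
  assumes "k > 0"
  shows "(f oo fps_X ^ k) $ n = (if k dvd n then f $ (n div k) else 0)"
proof -
  have "(f oo fps_X ^ k) $ n = (\<Sum>i = 0..n. if n = k * i then f $ i else 0)"
    unfolding fps_compose_nth by (intro sum.cong) (auto simp flip: power_mult)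
  also have "\<dots> = (if k dvd n then f $ (n div k) else 0)"
  proof (cases "k dvd n")
    case True
    then have "(n = k * i) = (i = n div k)" for i
      using assms by auto
    then show ?thesis
      using True by simp
  next
    case False
    then show ?thesis by (intro trans[OF sum.neutral]) auto
  qed
  finally show ?thesis .
qed

text \<open>In the convolution for \<open>f ^ 2\<close> the reflection of i to n - i cancels all but
  the middle term, and that term is the square of a bit, hence the bit itself.\<close>

lemma fps_bit_compose_X_square:
  fixes f :: "bit fps"
  shows "f oo fps_X ^ 2 = f ^ 2"
proof (rule fps_ext)
  fix n
  have "(f ^ 2) $ n = (\<Sum>i = 0..n. f $ i * f $ (n - i))"
    by (simp add: power2_eq_square fps_mult_nth)
  also have "\<dots> = (\<Sum>i | i \<in> {0..n} \<and> n - i = i. f $ i * f $ (n - i))"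
    by (rule sum_bit_involution) auto
  also have "{i. i \<in> {0..n} \<and> n - i = i} = (if even n then {n div 2} else {})"
    by (auto elim!: evenE oddE) presburger+
  also have "(\<Sum>i\<in>\<dots>. f $ i * f $ (n - i)) = (f oo fps_X ^ 2) $ n"
    by (cases "f $ (n div 2)") (auto simp: fps_nth_compose_X_power elim!: evenE)
  finally show "(f oo fps_X ^ 2) $ n = (f ^ 2) $ n" ..
qed

definition fps_section :: "nat \<Rightarrow> nat \<Rightarrow> 'a fps \<Rightarrow> 'a fps" where
  "fps_section m r f = Abs_fps (\<lambda>n. f $ (m * n + r))"

lemma fps_section_nth [simp]: "fps_section m r f $ n = f $ (m * n + r)"
  by (simp add: fps_section_def)

text \<open>A factor in q^m shifts exponents by multiples of m only, so it preserves residue classes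
  and leaves the section with q^m renamed to q.\<close>

lemma fps_section_mult_compose:
  fixes f g :: "'a::idom fps"
  assumes "r < m"
  shows "fps_section m r (f * (g oo fps_X ^ m)) = fps_section m r f * g"
proof (rule fps_ext)
  fix n
  have "fps_section m r (f * (g oo fps_X ^ m)) $ n =
      (\<Sum>i = 0..m * n + r. (if m dvd i then g $ (i div m) * f $ (m * n + r - i) else 0))"
    unfolding fps_section_nth mult.commute[of f] fps_mult_nth
    using assms by (intro sum.cong) (auto simp: fps_nth_compose_X_power)
  also have "\<dots> = (\<Sum>i\<in>{i \<in> {0..m * n + r}. m dvd i}. g $ (i div m) * f $ (m * n + r - i))"
    by (rule sum.inter_filter[symmetric]) simp
  also have "\<dots> = (\<Sum>j = 0..n. g $ j * f $ (m * (n - j) + r))"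
  proof (rule sum.reindex_bij_witness[where i = "\<lambda>j. m * j" and j = "\<lambda>i. i div m"])
    fix i assume "i \<in> {i \<in> {0..m * n + r}. m dvd i}"
    then obtain j where [simp]: "i = m * j" and le: "m * j \<le> m * n + r" by auto
    \<comment> \<open>Here \<open>r < m\<close> matters: the multiple m (n + 1) already exceeds m n
      + r.\<close>
    have "\<not> n + 1 \<le> j"
    proof
      assume "n + 1 \<le> j"
      then have "m * (n + 1) \<le> m * j" by (rule mult_le_mono2)
      with le assms show False by simp
    qed
    then have j: "j \<le> n" by simp
    show "i div m \<in> {0..n}" "m * (i div m) = i" using j assms by auto
    have "m * n + r - m * j = m * (n - j) + r"
      using j by (simp add: diff_mult_distrib2)
    then show "g $ (i div m) * f $ (m * (n - (i div m)) + r) = g $ (i div m) * f $ (m * n + r - i)"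
      using assms by simp
  qed (use assms in \<open>auto intro: trans_le_add1\<close>)
  also have "\<dots> = (fps_section m r f * g) $ n"
    by (simp add: mult.commute[of _ g] fps_mult_nth)
  finally show "fps_section m r (f * (g oo fps_X ^ m)) $ n = (fps_section m r f * g) $ n" .
qed

subsection \<open>Gauss's identity for triangular numbers modulo 2\<close>

definition qp :: "nat \<Rightarrow> 'a::field fps" where
  "qp n = (\<Prod>j\<in>{1..n}. 1 - fps_X ^ j)"

lemma qp_0 [simp]: "qp 0 = 1"
  and qp_Suc: "qp (Suc n) = qp n * (1 - fps_X ^ Suc n)"
  by (simp_all add: qp_def)

lemma qp_nth_0 [simp]: "qp n $ 0 = 1"
  by (induction n) (simp_all add: qp_Suc)

lemma qp_nonzero [simp]: "qp n \<noteq> 0"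
  by (metis fps_zero_nth qp_nth_0 zero_neq_one)

text \<open>The Gaussian binomial. The value 0 for k > n keeps the Pascal rules valid at the end of
  a row, where truncated subtraction would give a nonzero quotient.\<close>

definition qbinomial :: "nat \<Rightarrow> nat \<Rightarrow> 'a::field fps" where
  "qbinomial n k = (if k \<le> n then qp n * inverse (qp k * qp (n - k)) else 0)"

lemma qbinomial_mult: "k \<le> n \<Longrightarrow> qbinomial n k * (qp k * qp (n - k)) = qp n"
  by (simp add: qbinomial_def mult.assoc inverse_mult_eq_1)

lemma qbinomial_0 [simp]: "qbinomial n 0 = 1"
  by (simp add: qbinomial_def inverse_mult_eq_1')

lemma qbinomial_symmetric: "k \<le> n \<Longrightarrow> qbinomial n (n - k) = qbinomial n k"
  by (simp add: qbinomial_def mult.commute)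

text \<open>Over the common denominator this is 1 - q^(n+1) = (1 - q^(k+1)) + q^(k+1) (1 -
  q^(n-k)).\<close>

lemma qbinomial_Suc_Suc:
  "qbinomial (Suc n) (Suc k) = qbinomial n k + fps_X ^ Suc k * (qbinomial n (Suc k) :: 'a::field fps)"
proof (cases "k < n")
  case True
  define m where "m = n - Suc k"
  have n: "n = k + Suc m" using True by (simp add: m_def)
  have "(qbinomial n k + fps_X ^ Suc k * qbinomial n (Suc k)) * (qp (Suc k) * qp (n - k))
      = qbinomial n k * (qp k * qp (n - k)) * (1 - fps_X ^ Suc k)
        + qbinomial n (Suc k) * (qp (Suc k) * qp (n - Suc k)) * (fps_X ^ Suc k * (1 - fps_X ^ Suc m))"
    by (simp add: n qp_Suc algebra_simps)
  also have "\<dots> = qp n * (1 - fps_X ^ Suc k + fps_X ^ Suc k * (1 - fps_X ^ Suc m))"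
    using True by (simp only: qbinomial_mult less_imp_le Suc_leI distrib_left)
  also have "1 - fps_X ^ Suc k + fps_X ^ Suc k * (1 - fps_X ^ Suc m) = (1 - fps_X ^ Suc n :: 'a fps)"
  proof -
    have "fps_X ^ Suc n = (fps_X ^ Suc k * fps_X ^ Suc m :: 'a fps)"
      unfolding power_add[symmetric] by (rule arg_cong[where f = "power fps_X"]) (simp add: n)
    then show ?thesis by (simp only: algebra_simps) simp
  qed
  also have "qp n * (1 - fps_X ^ Suc n) = qbinomial (Suc n) (Suc k) * (qp (Suc k) * qp (n - k))"
    using qbinomial_mult[of "Suc k" "Suc n", symmetric] True by (simp add: qp_Suc)
  finally show ?thesis by simp
qed (auto simp: qbinomial_def not_less le_Suc_eq inverse_mult_eq_1')

lemma qbinomial_Suc_Suc':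
  assumes "k \<le> n"
  shows "qbinomial (Suc n) (Suc k) = fps_X ^ (n - k) * qbinomial n k + qbinomial n (Suc k)"
proof (cases "k = n")
  case True
  then show ?thesis by (simp add: qbinomial_def inverse_mult_eq_1')
next
  case False
  then have k: "k < n" using assms by simp
  have "qbinomial (Suc n) (Suc k) = qbinomial (Suc n) (Suc (n - Suc k))"
    using qbinomial_symmetric[of "Suc k" "Suc n", symmetric] k by (simp add: Suc_diff_Suc)
  also have "\<dots> = qbinomial n (n - Suc k) + fps_X ^ (n - k) * qbinomial n (n - k)"
    using qbinomial_Suc_Suc[of n "n - Suc k"] unfolding Suc_diff_Suc[OF k] .
  finally show ?thesis
    using k by (simp add: qbinomial_symmetric add.commute)
qed

text \<open>Row 2n + 1 is symmetric; this is one half of it, read from the centre outwards. Without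
  the guard, truncated subtraction would give 1 beyond the end.\<close>

definition half_row :: "nat \<Rightarrow> nat \<Rightarrow> 'a::field fps" where
  "half_row n k = (if k \<le> n then qbinomial (2 * n + 1) (n - k) else 0)"

text \<open>The rule of \<open>half_row_Suc_Suc\<close> continued to the centre: the missing
  neighbour at position -1 equals the entry at 0 by symmetry of the row.\<close>

lemma half_row_Suc_0:
  "half_row (Suc n) 0 = fps_X ^ (n + 2) * half_row n 1 + (1 + fps_X ^ (2 * n + 2)) * half_row n 0
     + fps_X ^ (n + 1) * (half_row n 0 :: 'a::field fps)"
proof -
  have sym: "qbinomial (Suc (2 * n)) (Suc n) = (qbinomial (Suc (2 * n)) n :: 'a fps)"
    using qbinomial_symmetric[of n "Suc (2 * n)"] by simp
  have 1: "qbinomial (Suc (Suc (2 * n))) n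
      = half_row n 1 + fps_X ^ n * (qbinomial (Suc (2 * n)) n :: 'a fps)"
  proof (cases n)
    case (Suc m)
    then show ?thesis
      using qbinomial_Suc_Suc[of "Suc (2 * n)" m] by (simp add: half_row_def)
  qed (simp add: half_row_def)
  have "(half_row (Suc n) 0 :: 'a fps) = qbinomial (Suc (Suc (Suc (2 * n)))) (Suc n)"
    by (simp add: half_row_def)
  also have "\<dots> = fps_X ^ (n + 2) * qbinomial (Suc (Suc (2 * n))) n + qbinomial (Suc (Suc (2 * n))) (Suc n)"
    by (simp add: qbinomial_Suc_Suc'[of n "Suc (Suc (2 * n))"] Suc_diff_le)
  also have "qbinomial (Suc (Suc (2 * n))) (Suc n)
      = qbinomial (Suc (2 * n)) n + fps_X ^ Suc n * (qbinomial (Suc (2 * n)) n :: 'a fps)"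
    unfolding qbinomial_Suc_Suc[of "Suc (2 * n)" n] sym ..
  finally show ?thesis
    unfolding 1 by (simp add: half_row_def[of n 0] algebra_simps power_add mult_2 mult_2_right)
qed

text \<open>Two Pascal steps, one of each form. Mixing the forms makes the middle coefficient
  independent of k, as multiplication by (1 + q^(n+1))^2 requires.\<close>

lemma half_row_Suc_Suc:
  assumes "k \<le> n"
  shows "half_row (Suc n) (Suc k) = fps_X ^ (n + k + 3) * half_row n (k + 2)
    + (1 + fps_X ^ (2 * n + 2)) * half_row n (k + 1) + fps_X ^ (n - k) * (half_row n k :: 'a::field fps)"
proof (cases "k = n")
  case True
  then show ?thesis by (simp add: half_row_def)
next
  case False
  define i where "i = n - Suc k"
  have n: "n = k + Suc i" using False assms by (simp add: i_def)
  let ?N = "Suc (2 * n)"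
  have 1: "qbinomial (Suc ?N) i = half_row n (k + 2) + fps_X ^ i * (qbinomial ?N i :: 'a fps)"
    by (cases i) (simp_all add: half_row_def n qbinomial_Suc_Suc)
  have "(half_row (Suc n) (Suc k) :: 'a fps) = qbinomial (Suc (Suc ?N)) (Suc i)"
    by (simp add: half_row_def n)
  also have "\<dots> = fps_X ^ (n + k + 3) * qbinomial (Suc ?N) i + qbinomial (Suc ?N) (Suc i)"
  proof -
    have i: "i \<le> Suc ?N" and e: "Suc ?N - i = n + k + 3" by (simp_all add: n)
    show ?thesis using qbinomial_Suc_Suc'[OF i] unfolding e .
  qed
  also have "qbinomial (Suc ?N) (Suc i) = qbinomial ?N i + fps_X ^ Suc i * (qbinomial ?N (Suc i) :: 'a fps)"
    by (rule qbinomial_Suc_Suc)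
  finally have eq: "(half_row (Suc n) (Suc k) :: 'a fps) = fps_X ^ (n + k + 3) * (half_row n (k + 2) + fps_X ^ i * half_row n (k + 1))
      + (half_row n (k + 1) + fps_X ^ Suc i * half_row n k)"
    unfolding 1 by (simp add: half_row_def n)
  have "fps_X ^ (n + k + 3) * fps_X ^ i = (fps_X ^ (2 * n + 2) :: 'a fps)"
    unfolding power_add[symmetric] by (rule arg_cong[where f = "power fps_X"]) (simp add: n)
  moreover have "n - k = Suc i" by (simp add: n)
  ultimately show ?thesis
    unfolding eq by (simp add: algebra_simps del: power_Suc)
qed

text \<open>Half of the q-binomial theorem at row \<open>2n + 1\<close>: pairing the terms \<open>k\<close> and \<open>-1 - k\<close>
  removes the factor \<open>2 = 1 + q\<^sup>0\<close>, which would make the identity void in characteristic 2.\<close>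
lemma finite_gauss_identity:
  "(\<Prod>j\<in>{1..n}. 1 + fps_X ^ j) ^ 2 = (\<Sum>k\<le>n. half_row n k * fps_X ^ triangle k :: 'a::field fps)"
proof (induction n)
  case 0
  then show ?case by (simp add: half_row_def)
next
  case (Suc n)
  let ?x = "fps_X :: 'a fps"
  define B :: "nat \<Rightarrow> 'a fps" where "B k = half_row n k * ?x ^ triangle k" for k
  define S where "S = (\<Sum>k\<le>n. B k)"
  have B_0: "B k = 0" if "k > n" for k using that by (simp add: B_def half_row_def)
  have S1: "(\<Sum>k\<le>n. B (k + 1)) = S - B 0"
    using sum.atMost_Suc_shift[of B n] B_0[of "Suc n"] by (simp add: S_def)
  have S2: "(\<Sum>k\<le>n. B (k + 2)) = S - B 0 - B 1"
    using sum.atMost_Suc_shift[of "\<lambda>k. B (k + 1)" n] B_0[of "Suc (Suc n)"] S1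
    by (simp add: algebra_simps)
  have step: "half_row (Suc n) (Suc k) * ?x ^ triangle (Suc k) =
      ?x ^ (n + 1) * B (k + 2) + (1 + ?x ^ (2 * n + 2)) * B (k + 1) + ?x ^ (n + 1) * B k" if "k \<le> n" for k
  proof -
    \<comment> \<open>The weights absorb the dependence on k, because consecutive triangular numbers
      differ by k + 1 and k + 2.\<close>
    have 1: "?x ^ (n + k + 3) * ?x ^ triangle (Suc k) = ?x ^ (n + 1) * ?x ^ triangle (k + 2)"
      "?x ^ (n - k) * ?x ^ triangle (Suc k) = ?x ^ (n + 1) * ?x ^ triangle k"
      unfolding power_add[symmetric] by (rule arg_cong[where f = "power ?x"], use that in simp)+
    have "half_row (Suc n) (Suc k) * ?x ^ triangle (Suc k) =
       half_row n (k + 2) * (?x ^ (n + k + 3) * ?x ^ triangle (Suc k))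
       + (1 + ?x ^ (2 * n + 2)) * (half_row n (k + 1) * ?x ^ triangle (Suc k))
       + half_row n k * (?x ^ (n - k) * ?x ^ triangle (Suc k))"
      unfolding half_row_Suc_Suc[OF that] by (simp only: algebra_simps)
    then show ?thesis
      unfolding 1 B_def by (simp only: Suc_eq_plus1 algebra_simps)
  qed
  have start: "half_row (Suc n) 0 * ?x ^ triangle 0
      = ?x ^ (n + 1) * B 1 + (1 + ?x ^ (2 * n + 2)) * B 0 + ?x ^ (n + 1) * B 0"
    by (simp add: half_row_Suc_0 B_def algebra_simps)
  have "(\<Sum>k\<le>Suc n. half_row (Suc n) k * ?x ^ triangle k)
      = half_row (Suc n) 0 * ?x ^ triangle 0 + (\<Sum>k\<le>n. half_row (Suc n) (Suc k) * ?x ^ triangle (Suc k))"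
    by (rule sum.atMost_Suc_shift)
  also have "(\<Sum>k\<le>n. half_row (Suc n) (Suc k) * ?x ^ triangle (Suc k)) =
      (\<Sum>k\<le>n. ?x ^ (n + 1) * B (k + 2) + (1 + ?x ^ (2 * n + 2)) * B (k + 1) + ?x ^ (n + 1) * B k)"
    by (rule sum.cong[OF refl], rule step) simp
  also have "\<dots> = ?x ^ (n + 1) * (S - B 0 - B 1) + (1 + ?x ^ (2 * n + 2)) * (S - B 0) + ?x ^ (n + 1) * S"
    by (simp only: sum.distrib sum_distrib_left[symmetric] S1 S2 S_def[symmetric])
  \<comment> \<open>The central term supplies exactly the \<open>B 0\<close> and \<open>B 1\<close>
    missing from the shifted sums, so the outer coefficients add up to 2 q^(n+1) S.\<close>
  also have "half_row (Suc n) 0 * ?x ^ triangle 0 + \<dots> = S * (1 + ?x ^ (n + 1)) ^ 2"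
  proof -
    have "?x ^ (2 * n + 2) = ?x ^ (n + 1) * ?x ^ (n + 1)"
      unfolding power_add[symmetric] by (rule arg_cong[where f = "power ?x"]) simp
    then show ?thesis
      unfolding start by (simp only: power2_eq_square) (simp only: algebra_simps mult_1_left)
  qed
  also have "S = (\<Prod>j\<in>{1..n}. 1 + ?x ^ j) ^ 2"
    unfolding S_def B_def by (rule Suc.IH[symmetric])
  also have "(\<Prod>j\<in>{1..n}. 1 + ?x ^ j) ^ 2 * (1 + ?x ^ (n + 1)) ^ 2 = (\<Prod>j\<in>{1..Suc n}. 1 + ?x ^ j) ^ 2"
    by (simp add: power_mult_distrib)
  finally show ?case by (rule sym)
qed

section \<open>Congruences modulo powers of q and the limit of the finite identity\<close>

lemma fps_X_power_dvd_iff: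
  fixes f :: "'a::comm_ring_1 fps"
  shows "fps_X ^ n dvd f \<longleftrightarrow> (\<forall>i<n. f $ i = 0)"
proof
  assume "fps_X ^ n dvd f"
  then show "\<forall>i<n. f $ i = 0" by (auto simp: dvd_def fps_X_power_mult_nth)
next
  assume "\<forall>i<n. f $ i = 0"
  then have "f = fps_X ^ n * fps_shift n f"
    by (auto simp: fps_eq_iff fps_X_power_mult_nth)
  then show "fps_X ^ n dvd f" by (rule dvdI)
qed

text \<open>The encoding of \<open>qpoch_fps\<close> over an arbitrary ring, so that the rational
  series and its reduction are instances of one definition.\<close>

definition euler_fps :: "nat \<Rightarrow> 'a::comm_ring_1 fps" where
  "euler_fps k = Abs_fps (\<lambda>n. (\<Prod>j\<in>{1..n}. 1 - fps_X ^ (k * j)) $ n)"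

lemma euler_fps_nth:
  assumes "k > 0" "n \<le> N"
  shows "euler_fps k $ n = (\<Prod>j\<in>{1..N}. 1 - fps_X ^ (k * j)) $ n"
  using \<open>n \<le> N\<close>
proof (induction N rule: dec_induct)
  case base
  then show ?case by (simp add: euler_fps_def)
next
  case (step N)
  have "n < k * Suc N" using step.hyps assms(1)
    by (metis One_nat_def Suc_leI le_imp_less_Suc less_le_trans mult_le_mono1 nat_mult_1)
  then show ?case
    using step.IH by (simp add: algebra_simps fps_X_power_mult_nth del: mult_Suc_right power_Suc)
qed

lemma euler_fps_nth_0 [simp]: "euler_fps k $ 0 = 1"
  by (simp add: euler_fps_def)

lemma euler_fps_compose_X_power:
  assumes "k > 0"
  shows "euler_fps k = (euler_fps 1 oo fps_X ^ k :: 'a::idom fps)"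
proof (rule fps_ext)
  fix n
  have "(euler_fps 1 oo fps_X ^ k :: 'a fps) $ n = ((\<Prod>j\<in>{1..n}. 1 - fps_X ^ j) oo fps_X ^ k) $ n"
    using assms euler_fps_nth[of 1 "n div k" n, where ?'a = 'a] by (simp add: fps_nth_compose_X_power)
  also have "(\<Prod>j\<in>{1..n}. 1 - fps_X ^ j) oo fps_X ^ k = (\<Prod>j\<in>{1..n}. 1 - (fps_X ^ (k * j) :: 'a fps))"
    using assms by (simp add: fps_compose_prod_distrib fps_compose_sub_distrib fps_X_power_compose power_mult)
  finally show "(euler_fps k :: 'a fps) $ n = (euler_fps 1 oo fps_X ^ k) $ n"
    using assms by (simp add: euler_fps_nth[of k n n])
qed

lemma X_power_dvd_euler_fps_minus_qp:
  assumes "N \<le> Suc n"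
  shows "fps_X ^ N dvd (euler_fps 1 - qp n :: 'a::field fps)"
  unfolding fps_X_power_dvd_iff
proof (intro allI impI)
  fix i assume "i < N"
  then show "(euler_fps 1 - qp n :: 'a fps) $ i = 0"
    using assms euler_fps_nth[of 1 i n, where ?'a = 'a] by (simp add: qp_def)
qed

text \<open>The entry is w / (u v) for three finite products that all agree with the infinite
  product E up to q^(n-k), the precision of the shortest one; so it is close to E / E^2.\<close>

lemma half_row_limit:
  assumes "k \<le> n"
  shows "fps_X ^ (n - k + 1) dvd (half_row n k * euler_fps 1 - 1 :: 'a::field fps)"
proof -
  define E where "E = (euler_fps 1 :: 'a fps)"
  define A where "A = (half_row n k :: 'a fps)"
  define u where "u = (qp (n - k) :: 'a fps)"
  define v where "v = (qp (n + k + 1) :: 'a fps)"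
  define w where "w = (qp (2 * n + 1) :: 'a fps)"
  have "2 * n + 1 - (n - k) = n + k + 1" using assms by simp
  then have Auv: "A * (u * v) = w"
    using assms qbinomial_mult[of "n - k" "2 * n + 1", where ?'a = 'a] by (simp add: A_def u_def v_def w_def half_row_def)
  have E: "E * inverse E = 1" by (simp add: E_def inverse_mult_eq_1')
  have "A * E - 1 = (A * E - 1) * (E * inverse E)"
    by (simp add: E)
  \<comment> \<open>From A u v = w, the difference A E^2 - E is A (E^2 - u v) - (E - w), and E^2 - u
    v is split by replacing one factor at a time.\<close>
  also have "\<dots> = (A * (E * (E - v) + (E - u) * v) - (E - w)) * inverse E"
    by (simp add: Auv[symmetric] algebra_simps)
  finally have "A * E - 1 = (A * (E * (E - v) + (E - u) * v) - (E - w)) * inverse E" .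
  moreover have "fps_X ^ (n - k + 1) dvd E - u" "fps_X ^ (n - k + 1) dvd E - v"
    "fps_X ^ (n - k + 1) dvd E - w"
    unfolding E_def u_def v_def w_def by (rule X_power_dvd_euler_fps_minus_qp, simp)+
  ultimately show ?thesis
    by (fold E_def A_def) (simp add: dvd_diff dvd_add)
qed

lemma fps_bit_one_minus: "1 - f = 1 + (f :: bit fps)"
  by (simp add: diff_conv_add_uminus fps_bit_uminus del: add_uminus_conv_diff)

lemma le_triangle: "n \<le> triangle n"
  by (induction n) auto

lemma inj_triangle: "inj triangle"
  by (rule strict_mono_on_imp_inj_on) (simp add: strict_mono_Suc_iff)

definition psi :: "bit fps" where
  "psi = Abs_fps (\<lambda>n. of_bool (n \<in> range triangle))"

lemma psi_nth: "psi $ n = of_bool (n \<in> range triangle)"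
  by (simp add: psi_def)

text \<open>Since 1 + q^j = 1 - q^j here, the left side of \<open>finite_gauss_identity\<close> is
  \<open>qp n ^ 2\<close>. Multiplied by E, it tends to E^3, while each coefficient on the right
  tends to 1.\<close>

lemma euler_fps_cube: "euler_fps 1 ^ 3 = psi"
proof (rule fps_ext)
  fix n
  define E where "E = (euler_fps 1 :: bit fps)"
  define T where "T = (\<Sum>k\<le>n. fps_X ^ triangle k :: bit fps)"
  have qp2: "qp n ^ 2 = (\<Sum>k\<le>n. half_row n k * fps_X ^ triangle k :: bit fps)"
    unfolding finite_gauss_identity[symmetric] by (simp add: qp_def fps_bit_one_minus)
  have "fps_X ^ Suc n dvd E * qp n ^ 2 - T"
  proof -
    have "E * qp n ^ 2 - T = (\<Sum>k\<le>n. (half_row n k * E - 1) * fps_X ^ triangle k)"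
      by (simp add: qp2 T_def sum_distrib_left sum_subtractf[symmetric] algebra_simps)
    moreover have "fps_X ^ Suc n dvd (half_row n k * E - 1) * fps_X ^ triangle k" if "k \<le> n" for k
    proof -
      have "fps_X ^ (n - k + 1 + triangle k) dvd (half_row n k * E - 1) * fps_X ^ triangle k"
        unfolding power_add[of _ "n - k + 1"] E_def using half_row_limit[OF that] by (rule mult_dvd_mono) simp
      \<comment> \<open>The k digits of precision lost in \<open>half_row_limit\<close> are regained
        from the factor q^(triangle k).\<close>
      moreover have "Suc n \<le> n - k + 1 + triangle k" using le_triangle[of k] by simp
      ultimately show ?thesis by (meson dvd_trans le_imp_power_dvd)
    qed
    ultimately show ?thesis by (auto intro!: dvd_sum simp del: power_Suc)
  qed
  moreover have "fps_X ^ Suc n dvd E * (E - qp n) * (E + qp n)"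
    using X_power_dvd_euler_fps_minus_qp[of "Suc n" n, where ?'a = bit]
    unfolding E_def by (intro dvd_mult2 dvd_mult) simp
  moreover have "E ^ 3 - T = (E * qp n ^ 2 - T) + E * (E - qp n) * (E + qp n)"
    by (simp add: power2_eq_square power3_eq_cube algebra_simps)
  ultimately have "fps_X ^ Suc n dvd E ^ 3 - T"
    by (simp only: dvd_add)
  then have "(E ^ 3 - T) $ n = 0"
    unfolding fps_X_power_dvd_iff by blast
  then have "(E ^ 3) $ n = T $ n" by (simp only: fps_sub_nth right_minus_eq)
  also have "T $ n = (\<Sum>k\<le>n. of_bool (triangle k = n))"
    unfolding T_def fps_sum_nth by (rule sum.cong) auto
  also have "\<dots> = of_bool (n \<in> range triangle)"
  proof (cases "n \<in> range triangle")
    case True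
    then obtain m where m: "n = triangle m" by auto
    have "(\<Sum>k\<le>n. of_bool (triangle k = n) :: bit) = (\<Sum>k\<le>n. if k = m then 1 else 0)"
      unfolding m by (rule sum.cong) (simp_all add: inj_eq[OF inj_triangle])
    also have "\<dots> = 1"
      using le_triangle[of m] unfolding m by simp
    finally show ?thesis
      unfolding m by simp
  next
    case False
    then have "(\<Sum>k\<le>n. of_bool (triangle k = n) :: bit) = 0"
      by (intro sum.neutral) auto
    with False show ?thesis by simp
  qed
  finally show "(euler_fps 1 ^ 3) $ n = psi $ n"
    by (simp add: E_def psi_nth)
qed

lemma psi_compose_nth:
  assumes "k > 0"
  shows "(psi oo fps_X ^ k) $ n = of_bool (\<exists>m. n = k * triangle m)"
  using assms by (auto simp: fps_nth_compose_X_power psi_nth elim!: dvdE)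

subsection \<open>The product of the theta series of the triangular numbers and their triples\<close>

lemma triangle_square: "8 * int (triangle n) + 1 = (2 * int n + 1) ^ 2"
  by (induction n) (simp_all add: power2_eq_square algebra_simps)

lemma of_nat_card_vimage_inj:
  assumes "inj f"
  shows "(of_nat (card {m. f m = n}) :: bit) = of_bool (\<exists>m. n = f m)"
proof (cases "\<exists>m. n = f m")
  case True
  then obtain m where "n = f m" by blast
  then have "{m. f m = n} = {m}" using assms by (auto simp: inj_eq)
  with True show ?thesis by simp
next
  case False
  then have "{m. f m = n} = {}" by auto
  with False show ?thesis by simp
qed

text \<open>The solutions of \<open>x\<^sup>2 + 3 y\<^sup>2 = 8 n + 4\<close> in odd \<open>x, y > 0\<close> correspond to solutions of
  \<open>s\<^sup>2 + 3 t\<^sup>2 = 2 n + 1\<close> via \<open>x = s + 3 t\<close> and \<open>\<plusminus>y = s - t\<close>, the sign being chosen so that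
  \<open>x \<equiv> \<plusminus>y (mod 4)\<close>.\<close>
lemma card_triangle_representations:
  "card {(a, b). triangle a + 3 * triangle b = n}
    = card {(s, t). s ^ 2 + 3 * t ^ 2 = 2 * int n + 1 \<and> s + 3 * t > 0}"
  (is "card ?S = card ?W")
proof -
  \<comment> \<open>With x = 2a + 1 and y = 2b + 1, one has x = y (mod 4) exactly when a + b is
    even. Then t = (x - y) / 4, and otherwise t = (x + y) / 4.\<close>
  define t where "t a b = (if even (a + b) then (int a - int b) div 2 else (int a + int b + 1) div 2)"
    for a b :: nat
  define g where "g = (\<lambda>(a, b). (2 * int a + 1 - 3 * t a b, t a b))"
  define h where "h = (\<lambda>(s, t). (nat ((s + 3 * t - 1) div 2), nat ((\<bar>s - t\<bar> - 1) div 2)))"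
  have t: "4 * t a b = (if even (a + b) then 2 * (int a - int b) else 2 * (int a + int b + 1))" for a b
  proof (cases "even (a + b)")
    case True
    then have "even (int a - int b)" by simp
    then obtain k where "int a - int b = 2 * k" by (rule evenE)
    then show ?thesis using True by (simp add: t_def)
  next
    case False
    then have "even (int a + int b + 1)" by simp
    then obtain k where "int a + int b + 1 = 2 * k" by (rule evenE)
    then show ?thesis using False by (simp add: t_def)
  qed
  have W: "\<exists>a b. s + 3 * t = 2 * int a + 1 \<and> \<bar>s - t\<bar> = 2 * int b + 1" if "(s, t) \<in> ?W" for s t
  proof -
    have "odd (s ^ 2 + 3 * t ^ 2)" using that by simp
    then have "odd (s + 3 * t)" "odd \<bar>s - t\<bar>" by auto
    then obtain a b where ab: "s + 3 * t = 2 * a + 1" "\<bar>s - t\<bar> = 2 * b + 1" by (elim oddE)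
    have "a \<ge> 0" "b \<ge> 0" using that ab by auto
    then show ?thesis using ab by (intro exI[of _ "nat a"] exI[of _ "nat b"]) simp
  qed
  have h: "h (s, t) = (a, b)" if "s + 3 * t = 2 * int a + 1" "\<bar>s - t\<bar> = 2 * int b + 1" for s t a b
    using that by (simp add: h_def)
  have iff: "triangle a + 3 * triangle b = n \<longleftrightarrow> s ^ 2 + 3 * t ^ 2 = 2 * int n + 1"
    if "s + 3 * t = 2 * int a + 1" "\<bar>s - t\<bar> = 2 * int b + 1" for s t a b
  proof -
    \<comment> \<open>Norms in (s + t sqrt(-3)) (1 - sqrt(-3)) = (s + 3t) + (t - s) sqrt(-3); the
      second factor has norm 4.\<close>
    have "4 * (s ^ 2 + 3 * t ^ 2) = (s + 3 * t) ^ 2 + 3 * \<bar>s - t\<bar> ^ 2"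
      by (simp add: power2_eq_square algebra_simps)
    also have "\<dots> = 8 * int (triangle a) + 1 + 3 * (8 * int (triangle b) + 1)"
      unfolding that triangle_square ..
    finally have "s ^ 2 + 3 * t ^ 2 = 2 * int (triangle a + 3 * triangle b) + 1"
      by (simp add: algebra_simps)
    then have "s ^ 2 + 3 * t ^ 2 = 2 * int n + 1 \<longleftrightarrow> int (triangle a + 3 * triangle b) = int n"
      by (simp only: add_right_cancel mult_cancel_left) simp
    then show ?thesis by (simp only: of_nat_eq_iff)
  qed
  have g: "\<exists>s t'. g (a, b) = (s, t') \<and> s + 3 * t' = 2 * int a + 1 \<and> \<bar>s - t'\<bar> = 2 * int b + 1" for a b
  proof (intro exI conjI)
    show "g (a, b) = (2 * int a + 1 - 3 * t a b, t a b)" by (simp add: g_def)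
    have "2 * int a + 1 - 4 * t a b = 2 * int b + 1 \<or> 2 * int a + 1 - 4 * t a b = - (2 * int b + 1)"
      by (cases "even (a + b)") (simp_all only: t if_True if_False, simp_all)
    then show "\<bar>2 * int a + 1 - 3 * t a b - t a b\<bar> = 2 * int b + 1" by linarith
  qed simp
  have gh: "g (a, b) = (s, t')" if "s + 3 * t' = 2 * int a + 1" "\<bar>s - t'\<bar> = 2 * int b + 1" for s t' a b
  proof -
    have "4 * t' = 2 * (int a - int b) \<or> 4 * t' = 2 * (int a + int b + 1)"
      using that by (cases "s \<ge> t'") (auto simp: abs_if)
    then have "t' = t a b"
    proof
      assume *: "4 * t' = 2 * (int a - int b)"
      then have "int (a + b) = 2 * (t' + int b)" by simp
      then have "even (int (a + b))" by (rule dvdI)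
      then have "even (a + b)" by (simp only: even_of_nat)
      then show ?thesis using t[of a b] * by simp
    next
      assume *: "4 * t' = 2 * (int a + int b + 1)"
      then have "int (a + b) + 1 = 2 * t'" by simp
      then have "odd (int (a + b))" by presburger
      then have "odd (a + b)" by (simp only: even_of_nat simp_thms)
      then show ?thesis using t[of a b] * by simp
    qed
    then show ?thesis using that by (simp add: g_def)
  qed
  have hg: "h (g (a, b)) = (a, b)" for a b
    using g[of a b] h by metis
  have gh': "g (h (s, t)) = (s, t)" if "(s, t) \<in> ?W" for s t
    using W[OF that] h gh by metis
  have "bij_betw g ?S ?W"
  proof (rule bij_betw_byWitness[where f' = h])
    show "\<forall>p\<in>?S. h (g p) = p" using hg by auto
    show "\<forall>p\<in>?W. g (h p) = p" using gh' by auto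
    show "g ` ?S \<subseteq> ?W"
    proof clarify
      fix a b s t'
      assume st: "(s, t') = g (a, b)" and n: "n = triangle a + 3 * triangle b"
      have *: "s + 3 * t' = 2 * int a + 1" "\<bar>s - t'\<bar> = 2 * int b + 1"
        using g[of a b] st by auto
      show "s ^ 2 + 3 * t' ^ 2 = 2 * int (triangle a + 3 * triangle b) + 1 \<and> 0 < s + 3 * t'"
        using iff[OF *] * n by simp
    qed
    show "h ` ?W \<subseteq> ?S"
    proof
      fix p assume "p \<in> h ` ?W"
      then obtain s t' where st: "(s, t') \<in> ?W" "p = h (s, t')" by auto
      from W[OF st(1)] obtain a b where *: "s + 3 * t' = 2 * int a + 1" "\<bar>s - t'\<bar> = 2 * int b + 1"
        by blast
      show "p \<in> ?S" using st iff[OF *] h[OF *] by auto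
    qed
  qed
  then show ?thesis by (rule bij_betw_same_card)
qed

lemma finite_square_plus_three_square: "finite {(s, t). s ^ 2 + 3 * t ^ 2 = (N::int)}"
proof (rule finite_subset)
  show "{(s, t). s ^ 2 + 3 * t ^ 2 = N} \<subseteq> {-N..N} \<times> {-N..N}"
  proof clarify
    fix s t :: int
    have "\<bar>x\<bar> \<le> x ^ 2" for x :: int
      using self_le_power[of "\<bar>x\<bar>" 2] by (cases "x = 0") auto
    from this[of s] this[of t] have "\<bar>s\<bar> \<le> s ^ 2 + 3 * t ^ 2" "\<bar>t\<bar> \<le> s ^ 2 + 3 * t ^ 2"
      using zero_le_power2[of s] zero_le_power2[of t] by linarith+
    then show "s \<in> {-(s ^ 2 + 3 * t ^ 2)..s ^ 2 + 3 * t ^ 2} \<and> t \<in> {-(s ^ 2 + 3 * t ^ 2)..s ^ 2 + 3 * t ^ 2}"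
      by auto
  qed
qed simp

text \<open>Up to a global sign, \<open>(s, t) \<mapsto> (s, -t)\<close> is an involution whose fixed points have \<open>s = 0\<close> or \<open>t = 0\<close>.\<close>
lemma parity_square_plus_three_square:
  "(of_nat (card {(s, t). s ^ 2 + 3 * t ^ 2 = 2 * int n + 1 \<and> s + 3 * t > 0}) :: bit)
    = of_bool (\<exists>m. n = 4 * triangle m) + of_bool (\<exists>m. n = 12 * triangle m + 1)"
proof -
  define W where "W = {(s, t). s ^ 2 + 3 * t ^ 2 = 2 * int n + 1 \<and> s + 3 * t > 0}"
  define h where "h = (\<lambda>(s::int, t). if s - 3 * t > 0 then (s, - t) else (- s, t))"
  \<comment> \<open>Fixed points on the axes: (2m+1)^2 = 2n + 1 means n = 4
    \<open>triangle m\<close>, and 3 (2m+1)^2 = 2n + 1 means n = 12 \<open>triangle m\<close> +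
    1.\<close>
  define F where "F = (\<lambda>m. (2 * int m + 1, 0::int)) ` {m. 4 * triangle m = n}"
  define G where "G = (\<lambda>m. (0::int, 2 * int m + 1)) ` {m. 12 * triangle m + 1 = n}"
  have fin: "finite W"
    by (rule finite_subset[OF _ finite_square_plus_three_square[of "2 * int n + 1"]]) (auto simp: W_def)
  \<comment> \<open>By parity no point lies on the line separating the two branches of
    \<open>h\<close>, so \<open>h\<close> stays in the half plane.\<close>
  have odd: "s - 3 * t \<noteq> 0" if "(s, t) \<in> W" for s t
  proof -
    have "odd (s ^ 2 + 3 * t ^ 2)" using that by (simp add: W_def)
    then have "odd (s - 3 * t)" by auto
    then show ?thesis by auto
  qed
  have "(of_nat (card W) :: bit) = (\<Sum>x\<in>W. 1)"
    by simp
  also have "\<dots> = (\<Sum>x | x \<in> W \<and> h x = x. 1)"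
  proof (rule sum_bit_involution[OF fin])
    fix x assume x: "x \<in> W"
    obtain s t where st: "x = (s, t)" by force
    show "h x \<in> W" "h (h x) = x"
      using x odd[of s t] by (auto simp: st h_def W_def)
  qed simp
  also have "{x \<in> W. h x = x} = F \<union> G"
  proof (intro equalityI subsetI)
    fix x assume x: "x \<in> {x \<in> W. h x = x}"
    obtain s t where st: "x = (s, t)" by force
    have eq: "s ^ 2 + 3 * t ^ 2 = 2 * int n + 1" and pos: "s + 3 * t > 0"
      using x by (auto simp: W_def st)
    have "t = 0 \<or> s = 0" using x by (auto simp: st h_def split: if_splits)
    then show "x \<in> F \<union> G"
    proof
      assume t: "t = 0"
      have "odd (s ^ 2)" using eq t by simp
      then have "odd s" by simp
      then obtain k where k: "s = 2 * k + 1" by (elim oddE)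
      define m where "m = nat k"
      have s: "s = 2 * int m + 1" using pos t k by (simp add: m_def)
      have "4 * triangle m = n" using eq triangle_square[of m] unfolding s t by simp
      then show ?thesis by (auto simp: F_def st s t)
    next
      assume s: "s = 0"
      have "odd (3 * t ^ 2)" using eq s by simp
      then have "odd t" by simp
      then obtain k where k: "t = 2 * k + 1" by (elim oddE)
      define m where "m = nat k"
      have t: "t = 2 * int m + 1" using pos s k by (simp add: m_def)
      have "12 * triangle m + 1 = n" using eq triangle_square[of m] unfolding s t by simp
      then show ?thesis by (auto simp: G_def st s t)
    qed
  next
    fix x assume "x \<in> F \<union> G"
    then show "x \<in> {x \<in> W. h x = x}"
      by (auto simp: F_def G_def W_def h_def simp flip: triangle_square)
  qed
  also have "(\<Sum>x\<in>F \<union> G. 1 :: bit) = of_nat (card F) + of_nat (card G)"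
  proof -
    have "m \<le> n" if "4 * triangle m = n \<or> 12 * triangle m + 1 = n" for m
      using that le_triangle[of m] by auto
    then have "finite {m. 4 * triangle m = n}" "finite {m. 12 * triangle m + 1 = n}"
      by (auto intro: finite_subset[of _ "{..n}"])
    then have "finite F" "finite G" by (simp_all add: F_def G_def)
    moreover have "F \<inter> G = {}" by (auto simp: F_def G_def)
    ultimately show ?thesis by (simp add: card_Un_disjoint)
  qed
  also have "card F = card {m. 4 * triangle m = n}"
    unfolding F_def by (rule card_image) (simp add: inj_on_def)
  also have "card G = card {m. 12 * triangle m + 1 = n}"
    unfolding G_def by (rule card_image) (simp add: inj_on_def)
  also have "of_nat (card {m. 4 * triangle m = n}) + of_nat (card {m. 12 * triangle m + 1 = n})
     = (of_bool (\<exists>m. n = 4 * triangle m) + of_bool (\<exists>m. n = 12 * triangle m + 1) :: bit)"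
    by (intro arg_cong2[where f = plus] of_nat_card_vimage_inj) (simp_all add: inj_def inj_eq[OF inj_triangle])
  finally show ?thesis by (simp only: W_def)
qed

lemma psi_mult_psi_compose_X_cube:
  "psi * (psi oo fps_X ^ 3) = (psi oo fps_X ^ 4) + fps_X * (psi oo fps_X ^ 12)"
proof (rule fps_ext)
  fix n
  define I where "I = {i \<in> {0..n}. (\<exists>a. i = triangle a) \<and> (\<exists>b. n - i = 3 * triangle b)}"
  have "(psi * (psi oo fps_X ^ 3)) $ n
      = (\<Sum>i = 0..n. if (\<exists>a. i = triangle a) \<and> (\<exists>b. n - i = 3 * triangle b) then 1 else 0)"
    unfolding fps_mult_nth by (rule sum.cong) (auto simp: psi_nth psi_compose_nth)
  also have "\<dots> = (\<Sum>i\<in>I. 1)"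
    unfolding I_def by (rule sum.inter_filter[symmetric]) simp
  also have "\<dots> = of_nat (card I)" by simp
  also have "card I = card {(a, b). triangle a + 3 * triangle b = n}"
  proof -
    \<comment> \<open>Convolution indices i correspond to pairs (a, b), since i and n - i determine
      a and b.\<close>
    have "inj_on (\<lambda>(a, b). triangle a) {(a, b). triangle a + 3 * triangle b = n}"
      by (auto intro!: inj_onI simp: inj_eq[OF inj_triangle])
    moreover have "(\<lambda>(a, b). triangle a) ` {(a, b). triangle a + 3 * triangle b = n} = I"
    proof (intro equalityI subsetI)
      fix i assume "i \<in> I"
      then obtain a b where "i = triangle a" "n - i = 3 * triangle b" "i \<le> n" by (auto simp: I_def)
      then have "(a, b) \<in> {(a, b). triangle a + 3 * triangle b = n}" "i = (\<lambda>(a, b). triangle a) (a, b)"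
        by auto
      then show "i \<in> (\<lambda>(a, b). triangle a) ` {(a, b). triangle a + 3 * triangle b = n}"
        by (rule rev_image_eqI)
    qed (auto simp: I_def)
    ultimately show ?thesis using card_image by metis
  qed
  also have "of_nat (card {(a, b). triangle a + 3 * triangle b = n})
      = (of_bool (\<exists>m. n = 4 * triangle m) + of_bool (\<exists>m. n = 12 * triangle m + 1) :: bit)"
    unfolding card_triangle_representations parity_square_plus_three_square ..
  also have "\<dots> = ((psi oo fps_X ^ 4) + fps_X * (psi oo fps_X ^ 12)) $ n"
    using triangle_0 by (cases n) (auto simp: psi_compose_nth psi_nth intro: range_eqI[of _ _ 0])
  finally show "(psi * (psi oo fps_X ^ 3)) $ n = ((psi oo fps_X ^ 4) + fps_X * (psi oo fps_X ^ 12)) $ n" .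
qed


subsection \<open>Dissections\<close>

lemma X_power_compose_X_power:
  fixes f :: "'a::idom fps"
  assumes "a > 0" "b > 0"
  shows "(f oo fps_X ^ a) oo fps_X ^ b = f oo fps_X ^ (a * b)"
proof -
  have "(f oo fps_X ^ a) oo fps_X ^ b = f oo (fps_X ^ a oo fps_X ^ b)"
    using assms by (intro fps_compose_assoc[symmetric]) auto
  also have "fps_X ^ a oo fps_X ^ b = (fps_X ^ (a * b) :: 'a fps)"
    using assms by (simp add: fps_X_power_compose mult.commute flip: power_mult)
  finally show ?thesis .
qed

lemma fps_bit_compose_X_4:
  fixes f :: "bit fps"
  shows "f oo fps_X ^ 4 = f ^ 4"
  using X_power_compose_X_power[of 2 2 f] by (simp add: fps_bit_compose_X_square flip: power_mult)

lemma psi_nth_0 [simp]: "psi $ 0 = 1"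
  using triangle_0 by (auto simp: psi_nth intro: range_eqI[of _ _ 0])

text \<open>Only indices k = 3q + 1 give triangular numbers that are 1 mod 3, and
  \<open>triangle (3 * q + 1)\<close> is 9 \<open>triangle q\<close> + 1.\<close>

lemma fps_section_3_1_psi: "fps_section 3 1 psi = psi oo fps_X ^ 3"
proof (rule fps_ext)
  fix n
  have "(3 * n + 1 \<in> range triangle) = (\<exists>m. n = 3 * triangle m)"
  proof
    assume "3 * n + 1 \<in> range triangle"
    then obtain k where k: "triangle k = 3 * n + 1" by auto
    have two: "2 * triangle j = j * (j + 1)" for j
      by (induction j) simp_all
    define q where "q = k div 3"
    consider "k = 3 * q" | "k = 3 * q + 1" | "k = 3 * q + 2"
      unfolding q_def by linarith
    then show "\<exists>m. n = 3 * triangle m"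
    proof cases
      case 1
      have "6 * n + 2 = 3 * (q * (3 * q + 1))"
        using two[of k] k unfolding 1 by simp
      then have False by presburger
      then show ?thesis ..
    next
      case 2
      have "6 * n + 2 = 9 * (q * (q + 1)) + 2"
        using two[of k] k unfolding 2 by (simp add: algebra_simps)
      then show ?thesis unfolding two[of q, symmetric] by (intro exI[of _ q]) simp
    next
      case 3
      have "6 * n + 2 = 3 * ((3 * q + 2) * (q + 1))"
        using two[of k] k unfolding 3 by (simp add: algebra_simps)
      then have False by presburger
      then show ?thesis ..
    qed
  next
    assume "\<exists>m. n = 3 * triangle m"
    then obtain m where n: "n = 3 * triangle m" by blast
    have "3 * n + 1 = triangle (3 * m + 1)"
      unfolding n by (induction m) (simp_all add: numeral_3_eq_3)
    then show "3 * n + 1 \<in> range triangle" by (rule range_eqI)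
  qed
  then show "fps_section 3 1 psi $ n = (psi oo fps_X ^ 3) $ n"
    by (simp add: psi_nth psi_compose_nth)
qed

definition j6_bit :: "bit fps" where
  "j6_bit = (euler_fps 2 * euler_fps 3 ^ 3 * inverse (euler_fps 1 * euler_fps 6 ^ 3)) ^ 3"

text \<open>With e = (q;q) and f = (q^3;q^3), the inner quotient is e^2 f^3 / (e f^6) = e / f^3. Its
  cube involves only e^3 and f^3, both known from \<open>euler_fps_cube\<close>.\<close>

lemma j6_bit_eq: "j6_bit = psi * (inverse psi ^ 3 oo fps_X ^ 3)"
proof -
  define e where "e = (euler_fps 1 :: bit fps)"
  define f where "f = (euler_fps 3 :: bit fps)"
  have e: "e * inverse e = 1" and f: "f * inverse f = 1"
    by (simp_all add: e_def f_def inverse_mult_eq_1')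
  have e2: "euler_fps 2 = e ^ 2"
    unfolding e_def by (subst euler_fps_compose_X_power) (simp_all add: fps_bit_compose_X_square)
  have f3: "f = e oo fps_X ^ 3"
    unfolding e_def f_def by (rule euler_fps_compose_X_power) simp
  have f6: "euler_fps 6 = f ^ 2"
  proof -
    have "euler_fps 6 = e oo fps_X ^ 6"
      unfolding e_def by (rule euler_fps_compose_X_power) simp
    also have "\<dots> = f oo fps_X ^ 2"
      using X_power_compose_X_power[of 3 2 e] by (simp add: f3)
    finally show ?thesis by (simp only: fps_bit_compose_X_square)
  qed
  have "e ^ 2 * f ^ 3 * inverse (e * (f ^ 2) ^ 3) = e * inverse f ^ 3 * (e * inverse e) * (f * inverse f) ^ 3"
    by (simp add: fps_inverse_mult numeral_eq_Suc mult_ac)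
  then have "j6_bit = (e * inverse f ^ 3) ^ 3"
    unfolding j6_bit_def e2 f6 e_def[symmetric] f_def[symmetric] by (simp add: e f)
  also have "\<dots> = e ^ 3 * inverse (f ^ 3) ^ 3"
    by (simp add: power_mult_distrib fps_inverse_power)
  also have "f ^ 3 = psi oo fps_X ^ 3"
    unfolding f3 e_def euler_fps_cube[symmetric] by (rule fps_compose_power) simp
  also have "inverse (psi oo fps_X ^ 3) ^ 3 = inverse psi ^ 3 oo fps_X ^ 3"
    by (simp add: fps_compose_power flip: fps_inverse_compose)
  finally show ?thesis unfolding e_def euler_fps_cube .
qed

lemma psi_inverse: "psi * inverse psi = 1"
  by (simp add: inverse_mult_eq_1')

lemma fps_section_j6_bit:
  "fps_section 3 1 j6_bit = ((psi oo fps_X ^ 4) + fps_X * (psi oo fps_X ^ 12)) * (inverse psi oo fps_X ^ 4)"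
proof -
  have "fps_section 3 1 j6_bit = (psi oo fps_X ^ 3) * inverse psi ^ 3"
    using fps_section_mult_compose[of 1 3 psi "inverse psi ^ 3"]
    unfolding j6_bit_eq fps_section_3_1_psi by simp
  \<comment> \<open>The extra factor turns the denominator into a fourth power, a series in
    q^4.\<close>
  also have "\<dots> = (psi oo fps_X ^ 3) * inverse psi ^ 3 * (psi * inverse psi)"
    by (simp add: psi_inverse)
  also have "\<dots> = (psi * (psi oo fps_X ^ 3)) * inverse psi ^ 4"
    by (simp add: numeral_eq_Suc mult_ac)
  finally show ?thesis by (simp add: psi_mult_psi_compose_X_cube fps_bit_compose_X_4)
qed

lemma fps_section_section_j6_bit:
  "fps_section 4 1 (fps_section 3 1 j6_bit)
    = ((psi oo fps_X ^ 4) + fps_X * (psi oo fps_X ^ 12)) * (inverse psi oo fps_X ^ 2)"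
proof -
  \<comment> \<open>The first summand has only exponents divisible by 4; the second has exponents
    12T + 1 and becomes psi(q^3).\<close>
  have "fps_section 4 1 ((psi oo fps_X ^ 4) + fps_X * (psi oo fps_X ^ 12)) = psi oo fps_X ^ 3"
  proof (rule fps_ext)
    fix n
    have "4 * n + 1 \<noteq> 4 * triangle m" for m by presburger
    moreover have "4 * n = 12 * triangle m \<longleftrightarrow> n = 3 * triangle m" for m by auto
    ultimately show "fps_section 4 1 ((psi oo fps_X ^ 4) + fps_X * (psi oo fps_X ^ 12)) $ n = (psi oo fps_X ^ 3) $ n"
      by (simp add: psi_compose_nth)
  qed
  then have "fps_section 4 1 (fps_section 3 1 j6_bit) = (psi oo fps_X ^ 3) * inverse psi"
    using fps_section_mult_compose[of 1 4 "(psi oo fps_X ^ 4) + fps_X * (psi oo fps_X ^ 12)" "inverse psi"]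
    unfolding fps_section_j6_bit by simp
  also have "\<dots> = (psi oo fps_X ^ 3) * inverse psi * (psi * inverse psi)"
    by (simp add: psi_inverse)
  also have "\<dots> = (psi * (psi oo fps_X ^ 3)) * inverse psi ^ 2"
    by (simp add: power2_eq_square mult_ac)
  finally show ?thesis by (simp add: psi_mult_psi_compose_X_cube fps_bit_compose_X_square)
qed

lemma fps_section_section_section_j6_bit:
  "fps_section 2 0 (fps_section 4 1 (fps_section 3 1 j6_bit)) = psi"
proof -
  \<comment> \<open>Now the second summand, with its odd exponents, is the one that
    disappears.\<close>
  have "fps_section 2 0 ((psi oo fps_X ^ 4) + fps_X * (psi oo fps_X ^ 12)) = psi oo fps_X ^ 2"
  proof (rule fps_ext)
    fix n
    have "2 * n = 4 * triangle m \<longleftrightarrow> n = 2 * triangle m" for m by auto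
    moreover have "2 * n - 1 \<noteq> 12 * triangle m" if "n > 0" for m using that by presburger
    ultimately show "fps_section 2 0 ((psi oo fps_X ^ 4) + fps_X * (psi oo fps_X ^ 12)) $ n = (psi oo fps_X ^ 2) $ n"
      by (simp add: psi_compose_nth)
  qed
  then have "fps_section 2 0 (fps_section 4 1 (fps_section 3 1 j6_bit)) = psi ^ 2 * inverse psi"
    using fps_section_mult_compose[of 0 2 "(psi oo fps_X ^ 4) + fps_X * (psi oo fps_X ^ 12)" "inverse psi"]
    unfolding fps_section_section_j6_bit by (simp add: fps_bit_compose_X_square)
  also have "\<dots> = psi * (psi * inverse psi)"
    by (simp add: power2_eq_square)
  finally show ?thesis by (simp add: psi_inverse)
qed

text \<open>The three extractions compose to 3 (4 (2n) + 1) + 1 = 24n + 4.\<close>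

lemma j6_bit_nth: "j6_bit $ (24 * n + 4) = of_bool (n \<in> range triangle)"
proof -
  have "j6_bit $ (24 * n + 4) = fps_section 2 0 (fps_section 4 1 (fps_section 3 1 j6_bit)) $ n"
    by (simp add: algebra_simps)
  then show ?thesis
    by (simp only: fps_section_section_section_j6_bit psi_nth)
qed

subsection \<open>Reduction modulo 2\<close>

text \<open>No ring homomorphism leads from \<open>rat\<close> to \<open>bit\<close>, so reduction
  is a relation through a common integer lift of each coefficient.\<close>

definition reduces :: "rat fps \<Rightarrow> bit fps \<Rightarrow> bool" where
  "reduces f g \<longleftrightarrow> (\<forall>n. \<exists>k::int. f $ n = of_int k \<and> g $ n = of_int k)"

lemma reducesE:
  assumes "reduces f g"
  obtains k :: "nat \<Rightarrow> int" where "\<And>n. f $ n = of_int (k n)" "\<And>n. g $ n = of_int (k n)"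
  using assms unfolding reduces_def by metis

lemma reduces_1: "reduces 1 1"
  unfolding reduces_def by (auto intro: exI[of _ 1] exI[of _ 0])

lemma reduces_one_minus_X_power: "reduces (1 - fps_X ^ m) (1 - fps_X ^ m)"
  unfolding reduces_def
proof
  fix n
  show "\<exists>k. (1 - fps_X ^ m :: rat fps) $ n = of_int k \<and> (1 - fps_X ^ m :: bit fps) $ n = of_int k"
    by (rule exI[of _ "(if n = 0 then 1 else 0) - (if n = m then 1 else 0)"])
      (simp only: fps_sub_nth fps_one_nth fps_X_power_nth of_int_diff, simp)
qed

lemma reduces_mult:
  assumes "reduces f g" "reduces f' g'"
  shows "reduces (f * f') (g * g')"
proof -
  from assms(1) obtain k where k: "\<And>n. f $ n = of_int (k n)" "\<And>n. g $ n = of_int (k n)"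
    by (rule reducesE) metis
  from assms(2) obtain k' where k': "\<And>n. f' $ n = of_int (k' n)" "\<And>n. g' $ n = of_int (k' n)"
    by (rule reducesE) metis
  have "(f * f') $ n = of_int (\<Sum>i = 0..n. k i * k' (n - i))"
    "(g * g') $ n = of_int (\<Sum>i = 0..n. k i * k' (n - i))" for n
    by (simp_all add: fps_mult_nth k k')
  then show ?thesis unfolding reduces_def by blast
qed

lemma reduces_power: "reduces f g \<Longrightarrow> reduces (f ^ n) (g ^ n)"
  by (induction n) (auto intro: reduces_1 reduces_mult)

lemma reduces_prod: "(\<And>x. x \<in> A \<Longrightarrow> reduces (f x) (g x)) \<Longrightarrow> reduces (prod f A) (prod g A)"
  by (induction A rule: infinite_finite_induct) (auto intro: reduces_1 reduces_mult)

text \<open>Constant term 1 makes the recursion for the coefficients of the inverse free of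
  division, so integrality passes from smaller indices to larger ones.\<close>

lemma reduces_inverse:
  assumes "reduces f g" "f $ 0 = 1"
  shows "reduces (inverse f) (inverse g)"
proof -
  from assms(1) obtain k where k: "\<And>n. f $ n = of_int (k n)" "\<And>n. g $ n = of_int (k n)"
    by (rule reducesE) metis
  have k0: "k 0 = 1" using assms(2) k(1)[of 0] by simp
  have nth: "inverse h $ n = (if n = 0 then 1 else - (\<Sum>i = 1..n. h $ i * inverse h $ (n - i)))"
    if "h $ 0 = 1" for h :: "'a::field fps" and n
  proof (cases n)
    case (Suc m)
    have "(h * inverse h) $ n = 0"
      using inverse_mult_eq_1'[of h] that Suc by simp
    then have "(\<Sum>i = 0..n. h $ i * inverse h $ (n - i)) = 0"
      unfolding fps_mult_nth .
    then have "inverse h $ n + (\<Sum>i = 1..n. h $ i * inverse h $ (n - i)) = 0"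
      using that sum.atLeast_Suc_atMost[of 0 n "\<lambda>i. h $ i * inverse h $ (n - i)"] by simp
    then show ?thesis
      unfolding eq_neg_iff_add_eq_0[symmetric] using Suc by simp
  qed (use that in simp)
  have "\<exists>l. inverse f $ n = of_int l \<and> inverse g $ n = of_int l" for n
  proof (induction n rule: less_induct)
    case (less n)
    then obtain l where l: "\<And>m. m < n \<Longrightarrow> inverse f $ m = of_int (l m)"
      "\<And>m. m < n \<Longrightarrow> inverse g $ m = of_int (l m)" by metis
    have "(\<Sum>i = 1..n. f $ i * inverse f $ (n - i)) = of_int (\<Sum>i = 1..n. k i * l (n - i))"
      "(\<Sum>i = 1..n. g $ i * inverse g $ (n - i)) = of_int (\<Sum>i = 1..n. k i * l (n - i))"
      unfolding of_int_sum by (rule sum.cong; simp add: k l)+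
    then show ?case
      using nth[of f n] nth[of g n] k k0
      by (intro exI[of _ "if n = 0 then 1 else - (\<Sum>i = 1..n. k i * l (n - i))"]) simp
  qed
  then show ?thesis by (simp add: reduces_def)
qed

lemma reduces_euler_fps: "reduces (euler_fps k) (euler_fps k)"
proof -
  have "reduces (\<Prod>j\<in>{1..n}. 1 - fps_X ^ (k * j)) (\<Prod>j\<in>{1..n}. 1 - fps_X ^ (k * j))" for n
    by (intro reduces_prod reduces_one_minus_X_power)
  then show ?thesis by (simp add: reduces_def euler_fps_def)
qed

lemma reduces_j6_G: "reduces j6_G j6_bit"
proof -
  have "qpoch_fps k = euler_fps k" for k
    by (simp add: qpoch_fps_def euler_fps_def)
  then show ?thesis
    unfolding j6_G_def j6_bit_def
    by (auto intro!: reduces_power reduces_mult reduces_inverse reduces_euler_fps simp: fps_nth_power_0)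
qed

lemma J6_even_iff: "(\<exists>k::int. J6 (24 * n + 3) = of_int (2 * k)) \<longleftrightarrow> n \<notin> range triangle"
proof -
  obtain k where k: "j6_G $ (24 * n + 4) = of_int k" "j6_bit $ (24 * n + 4) = of_int k"
    using reduces_j6_G by (auto simp: reduces_def)
  \<comment> \<open>The factor 1/q shifts the index by one, and the constant 3 affects only index
    0.\<close>
  have "J6 (24 * n + 3) = of_int k"
    using k(1) by (simp add: J6_def add.commute)
  then have "(\<exists>l::int. J6 (24 * n + 3) = of_int (2 * l)) \<longleftrightarrow> even k"
    by (simp only: of_int_eq_iff dvd_def)
  also have "\<dots> \<longleftrightarrow> n \<notin> range triangle"
    using k(2) unfolding j6_bit_nth of_int_bit by (auto simp: of_bool_def split: if_splits)
  finally show ?thesis .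
qed

subsection \<open>Triangular numbers have density zero\<close>

text \<open>From k^2 <= 2 \<open>triangle k\<close>, the index is at most sqrt(2X); the added 1
  accounts for k = 0.\<close>

lemma card_triangle_le:
  assumes "X \<ge> 0"
  shows "real (card {n \<in> range triangle. real n \<le> X}) \<le> sqrt (2 * X) + 1"
proof -
  define N where "N = nat \<lfloor>sqrt (2 * X)\<rfloor>"
  have sub: "{n \<in> range triangle. real n \<le> X} \<subseteq> triangle ` {..N}"
  proof clarify
    fix k assume k: "real (triangle k) \<le> X"
    have "k * k \<le> 2 * triangle k" by (induction k) simp_all
    then have "real (k * k) \<le> real (2 * triangle k)" by (simp only: of_nat_le_iff)
    then have "(real k) ^ 2 \<le> 2 * X" using k by (simp add: power2_eq_square)
    then have "real k \<le> sqrt (2 * X)" by (rule real_le_rsqrt)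
    then have "k \<le> N" unfolding N_def by linarith
    then show "triangle k \<in> triangle ` {..N}" by simp
  qed
  have "card {n \<in> range triangle. real n \<le> X} \<le> card (triangle ` {..N})"
    using sub by (intro card_mono) simp_all
  also have "\<dots> \<le> N + 1" using card_image_le[of "{..N}" triangle] by simp
  finally have "card {n \<in> range triangle. real n \<le> X} \<le> N + 1" .
  then show "real (card {n \<in> range triangle. real n \<le> X}) \<le> sqrt (2 * X) + 1"
  proof -
    have "real N \<le> sqrt (2 * X)" unfolding N_def using assms by (intro of_nat_floor) simp
    with \<open>card {n \<in> range triangle. real n \<le> X} \<le> N + 1\<close> show ?thesis by linarith
  qed
qed

theorem theorem3p2:
  shows "((\<lambda>X::real. real (card {n::nat. real n \<le> X \<and>
            (\<exists>k::int. J6 (24 * n + 3) = of_int (2 * k))}) / X)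
          \<longlongrightarrow> 1) at_top"
proof -
  define c where "c X = real (card {n::nat. real n \<le> X \<and> (\<exists>k::int. J6 (24 * n + 3) = of_int (2 * k))})"
    for X :: real
  \<comment> \<open>Counting from 0 gives floor(X) + 1 numbers in all, between X and X + 1; the
    triangular ones are then removed.\<close>
  have bounds: "X - (sqrt (2 * X) + 1) \<le> c X" "c X \<le> X + 1" if "X \<ge> 0" for X
  proof -
    define A where "A = {n::nat. real n \<le> X}"
    define T where "T = {n \<in> range triangle. real n \<le> X}"
    have A: "A = {..nat \<lfloor>X\<rfloor>}" unfolding A_def using that by (auto simp: le_nat_iff le_floor_iff)
    then have cA: "finite A" "real (card A) \<le> X + 1" "X \<le> real (card A)"
      using that by simp_all linarith+
    have c: "c X = real (card (A - T))"
      unfolding c_def J6_even_iff A_def T_def by (intro arg_cong[where f = "\<lambda>S. real (card S)"]) auto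
    have "T \<subseteq> A" by (auto simp: A_def T_def)
    then have "c X = real (card A) - real (card T)"
      using cA(1) card_mono[OF cA(1)] unfolding c by (simp add: card_Diff_subset finite_subset of_nat_diff)
    then show "X - (sqrt (2 * X) + 1) \<le> c X" "c X \<le> X + 1"
      using cA(2,3) card_triangle_le[OF that] by (simp_all add: T_def)
  qed
  have "((\<lambda>X. c X / X) \<longlongrightarrow> 1) at_top"
  proof (rule tendsto_sandwich)
    show "((\<lambda>X::real. (X - (sqrt (2 * X) + 1)) / X) \<longlongrightarrow> 1) at_top"
      by real_asymp
    show "((\<lambda>X::real. (X + 1) / X) \<longlongrightarrow> 1) at_top"
      by real_asymp
    show "\<forall>\<^sub>F X in at_top. (X - (sqrt (2 * X) + 1)) / X \<le> c X / X"
      using eventually_ge_at_top[of 0] by eventually_elim (intro divide_right_mono bounds)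
    show "\<forall>\<^sub>F X in at_top. c X / X \<le> (X + 1) / X"
      using eventually_ge_at_top[of 0] by eventually_elim (intro divide_right_mono bounds)
  qed
  then show ?thesis by (simp only: c_def)
qed

end
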